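(* Let $F^*_1=\partial_x$, $G^*_1=(y^2-x^2)\partial_x-2xy\,\partial_y$, $H^*_1=2(x\partial_x+y\partial_y)$. (1) The fundamental vector fields of the action of $G^J(\mathbb{R})_0$ on the Siegel--Jacobi upper half-plane $\mathcal{X}^J_1$ attached to the generators $F,G,H,P,Q,R$ are, in the coordinates $(\tau,z)$, the holomorphic vector fields $$F^*=\partial_\tau,\quad G^*=-\tau^2\partial_\tau-z\tau\,\partial_z,\quad H^*=2\tau\partial_\tau+z\partial_z,\quad P^*=\tau\partial_z,\quad Q^*=\partial_z,\quad R^*=0.$$ In the real variables $(x,y,\xi,\eta)$, $\tau=x+\mathrm{i}y$, $z=\xi+\mathrm{i}\eta$, they are $$F^*=F^*_1,\quad G^*=G^*_1+(\eta y-\xi x)\partial_\xi-(\xi y+x\eta)\partial_\eta,\quad H^*=H^*_1+\xi\partial_\xi+\eta\partial_\eta,$$ $$P^*=x\partial_\xi+y\partial_\eta,\quad Q^*=\partial_\xi,\quad R^*=0.$$ In the variables $(x,y,p,q)$, $\xi=px+q$, $\eta=py$, they are $$F^*=F^*_1-p\partial_q,\quad G^*=G^*_1-q\partial_p,\quad H^*=H^*_1-p\partial_p+q\partial_q,\quad P^*=\partial_p,\quad Q^*=\partial_q,\quad R^*=0.$$ (2) The fundamental vector fields of the action of $G^J_1(\mathbb{R})$ on the extended Siegel--Jacobi upper half-plane $\tilde{\mathcal{X}}^J_1$ are, in the coordinates $(\tau,z,\kappa)$, with $p=\frac{\operatorname{Im}z}{\operatorname{Im}\tau}$, $q=\frac{\operatorname{Im}(\bar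 z\tau)}{\operatorname{Im}\tau}$, $$F^*=\partial_\tau,\quad G^*=-\tau^2\partial_\tau-z\tau\,\partial_z,\quad H^*=2\tau\partial_\tau+z\partial_z,\quad P^*=\tau\partial_z+q\partial_\kappa,\quad Q^*=\partial_z-p\partial_\kappa,\quad R^*=\partial_\kappa.$$ In the variables $(x,y,\xi,\eta,\kappa)$ they are $$F^*=F^*_1,\quad G^*=G^*_1+(\eta y-\xi x)\partial_\xi-(\xi y+x\eta)\partial_\eta,\quad H^*=H^*_1+\xi\partial_\xi+\eta\partial_\eta,$$ $$P^*=x\partial_\xi+y\partial_\eta+q\partial_\kappa,\quad Q^*=\partial_\xi-p\partial_\kappa,\quad R^*=\partial_\kappa.$$ In the variables $(x,y,p,q,\kappa)$ they are $$F^*=F^*_1-p\partial_q,\quad G^*=G^*_1-q\partial_p,\quad H^*=H^*_1-p\partial_p+q\partial_q,\quad P^*=\partial_p+q\partial_\kappa,\quad Q^*=\partial_q-p\partial_\kappa,\quad R^*=\partial_\kappa.$$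
   Context: The real Jacobi group $G^J_1(\mathbb{R})$ consists of triples $(M,X,\kappa)$, $M=\begin{pmatrix}a&b\\ c&d\end{pmatrix}\in\mathrm{SL}(2,\mathbb{R})$, $X=(\lambda,\mu)\in\mathbb{R}^2$, $\kappa\in\mathbb{R}$, with product $(M,X,\kappa)(M',X',\kappa')=\big(MM',\,XM'+X',\,\kappa+\kappa'+\det\begin{pmatrix}XM'\\ X'\end{pmatrix}\big)$; $G^J(\mathbb{R})_0$ is the quotient group of pairs $(M,X)$. One-parameter subgroups of the generators: $\exp(tF)$, $\exp(tG)$, $\exp(tH)$ have $X=0,\kappa=0$ and $M=\begin{pmatrix}1&t\\ 0&1\end{pmatrix},\begin{pmatrix}1&0\\ t&1\end{pmatrix},\begin{pmatrix}e^t&0\\ 0&e^{-t}\end{pmatrix}$ respectively; $\exp(tP)$, $\exp(tQ)$, $\exp(tR)$ have $M=1$ and $(\lambda,\mu,\kappa)=(t,0,0),(0,t,0),(0,0,t)$ respectively. $\mathcal{X}^J_1$ is the set of $(\tau,z)$ with $\operatorname{Im}\tau>0$, $z\in\mathbb{C}$; write $\tau=x+\mathrm{i}y$, $z=\xi+\mathrm{i}\eta=p\tau+q$ with $p,q\in\mathbb{R}$. $G^J(\mathbb{R})_0$ acts by $(M,X)\cdot(\tau,z)=\big(\frac{a\tau+b}{c\tau+d},\frac{z+\lambda\tau+\mu}{c\tau+d}\big)$ (the element $R$ acts trivially). $\tilde{\mathcal{X}}^J_1=\mathcal{X}^J_1\times\mathbb{R}\ni(\tau,z,\kappa)$, and $G^J_1(\mathbb{R})$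 acts by the same formulas on $(\tau',z')$ together with $\kappa_1=\kappa+\kappa'+\lambda q'-\mu p'$, where $z'=p'\tau'+q'$. The fundamental vector field of a Lie algebra element $Z$ is $Z^*_m=\frac{\mathrm{d}}{\mathrm{d}t}\big|_{t=0}\exp(tZ)\cdot m$. When written in the complex coordinates, a holomorphic expression $f\partial_\tau+h\partial_z$ (possibly plus a real multiple of $\partial_\kappa$) records $\dot\tau=f$, $\dot z=h$, i.e. it stands for the real vector field $\operatorname{Re}f\,\partial_x+\operatorname{Im}f\,\partial_y+\operatorname{Re}h\,\partial_\xi+\operatorname{Im}h\,\partial_\eta$ (plus the $\partial_\kappa$ term). *)

theory Defs
  imports "HOL-Analysis.Analysis" "HOL-Algebra.Group_Action"
begin

section \<open>The real Jacobi group and its quotient by the centre\<close>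

text \<open>A pair \<open>X = (\<lambda>, \<mu>)\<close> is a row vector, so that \<open>X M'\<close> is \<open>X v* M'\<close>.\<close>

definition GJ1 :: "((real^2^2) \<times> (real^2) \<times> real) monoid" where
  "GJ1 = \<lparr>carrier = {(M, X, k). det M = 1},
     mult = (\<lambda>(M, X, k) (M', X', k').
       (M ** M', X v* M' + X', k + k' + det (vector [X v* M', X'] :: real^2^2))),
     one = (mat 1, 0, 0)\<rparr>"

definition GJ0 :: "((real^2^2) \<times> (real^2)) monoid" where
  "GJ0 = \<lparr>carrier = {(M, X). det M = 1},
     mult = (\<lambda>(M, X) (M', X'). (M ** M', X v* M' + X')),
     one = (mat 1, 0)\<rparr>"

definition GJ_proj :: "(real^2^2) \<times> (real^2) \<times> real \<Rightarrow> (real^2^2) \<times> (real^2)" where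
  "GJ_proj = (\<lambda>(M, X, k). (M, X))"

datatype generator = GenF | GenG | GenH | GenP | GenQ | GenR

fun exp_GJ1 :: "generator \<Rightarrow> real \<Rightarrow> (real^2^2) \<times> (real^2) \<times> real" where
  "exp_GJ1 GenF t = (vector [vector [1, t], vector [0, 1]], 0, 0)"
| "exp_GJ1 GenG t = (vector [vector [1, 0], vector [t, 1]], 0, 0)"
| "exp_GJ1 GenH t = (vector [vector [exp t, 0], vector [0, exp (- t)]], 0, 0)"
| "exp_GJ1 GenP t = (mat 1, vector [t, 0], 0)"
| "exp_GJ1 GenQ t = (mat 1, vector [0, t], 0)"
| "exp_GJ1 GenR t = (mat 1, 0, t)"

definition exp_GJ0 :: "generator \<Rightarrow> real \<Rightarrow> (real^2^2) \<times> (real^2)" where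
  "exp_GJ0 Z t = GJ_proj (exp_GJ1 Z t)"


section \<open>The Siegel--Jacobi spaces and the actions\<close>

definition SJ :: "(complex \<times> complex) set" where
  "SJ = {(\<tau>, z). Im \<tau> > 0}"

definition SJ_ext :: "(complex \<times> complex \<times> real) set" where
  "SJ_ext = {(\<tau>, z, k). Im \<tau> > 0}"

text \<open>The real pair \<open>(p, q)\<close> with \<open>z = p \<tau> + q\<close>; it is unique because \<open>Im \<tau> > 0\<close>.\<close>

definition pq :: "complex \<Rightarrow> complex \<Rightarrow> real \<times> real" where
  "pq \<tau> z = (THE r. z = of_real (fst r) * \<tau> + of_real (snd r))"

definition act_GJ0 :: "(real^2^2) \<times> (real^2) \<Rightarrow> complex \<times> complex \<Rightarrow> complex \<times> complex" where
  "act_GJ0 = (\<lambda>(M, X) (\<tau>, z).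
     ((of_real (M$1$1) * \<tau> + of_real (M$1$2)) / (of_real (M$2$1) * \<tau> + of_real (M$2$2)),
      (z + of_real (X$1) * \<tau> + of_real (X$2)) / (of_real (M$2$1) * \<tau> + of_real (M$2$2))))"

definition act_GJ1 ::
  "(real^2^2) \<times> (real^2) \<times> real \<Rightarrow> complex \<times> complex \<times> real \<Rightarrow> complex \<times> complex \<times> real" where
  "act_GJ1 = (\<lambda>(M, X, k) (\<tau>', z', k').
     let (\<tau>, z) = act_GJ0 (M, X) (\<tau>', z'); (p', q') = pq \<tau>' z'
     in (\<tau>, z, k + k' + X$1 * q' - X$2 * p'))"


section \<open>Fundamental vector fields and their coordinate expressions\<close>

text \<open>
  \<open>SJ\<close> and \<open>SJ_ext\<close> are open in \<open>\<complex> \<times> \<complex>\<close> and \<open>\<complex> \<times> \<complex> \<times> \<real>\<close>, so a vector field is a function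
  into the ambient real vector space. The value \<open>(f, h)\<close>, or \<open>(f, h, r)\<close>, is
  \<open>f \<partial>\<^sub>\<tau> + h \<partial>\<^sub>z\<close> (plus \<open>r \<partial>\<^sub>\<kappa>\<close>) read as the velocity
  \<open>d\<tau>/dt = f\<close>, \<open>dz/dt = h\<close> (and \<open>d\<kappa>/dt = r\<close>).
\<close>

definition is_fundamental_field ::
  "'m set \<Rightarrow> ('g \<Rightarrow> 'm \<Rightarrow> 'm) \<Rightarrow> (real \<Rightarrow> 'g) \<Rightarrow> ('m \<Rightarrow> 'm::real_normed_vector) \<Rightarrow> bool" where
  "is_fundamental_field S act \<gamma> V \<longleftrightarrow>
     (\<forall>m\<in>S. ((\<lambda>t. act (\<gamma> t) m) has_vector_derivative V m) (at 0))"

text \<open>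
  The field \<open>V\<close> has coefficient functions \<open>W\<close> in the coordinates \<open>\<phi> = (u\<^sub>1, \<dots>, u\<^sub>n)\<close>, that is
  \<open>V = \<Sum>i. W\<^sub>i(u) \<partial>/\<partial>u\<^sub>i\<close>: the differential of \<open>\<phi>\<close> maps \<open>V\<close> to \<open>W\<close>.
\<close>

definition expressed_in_coords ::
  "'m set \<Rightarrow> ('m \<Rightarrow> 'c) \<Rightarrow> ('m \<Rightarrow> 'm::real_normed_vector) \<Rightarrow> ('c \<Rightarrow> 'c::real_normed_vector) \<Rightarrow> bool"
  where
  "expressed_in_coords S \<phi> V W \<longleftrightarrow>
     (\<forall>m\<in>S. \<exists>D. (\<phi> has_derivative D) (at m) \<and> D (V m) = W (\<phi> m))"

definition is_fundamental_field_in ::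
  "('m \<Rightarrow> 'c) \<Rightarrow> 'm::real_normed_vector set \<Rightarrow> ('g \<Rightarrow> 'm \<Rightarrow> 'm) \<Rightarrow> (real \<Rightarrow> 'g)
    \<Rightarrow> ('c \<Rightarrow> 'c::real_normed_vector) \<Rightarrow> bool" where
  "is_fundamental_field_in \<phi> S act \<gamma> W \<longleftrightarrow>
     (\<exists>V. is_fundamental_field S act \<gamma> V \<and> expressed_in_coords S \<phi> V W)"

text \<open>A holomorphic field has a \<open>\<complex>\<close>-linear differential at every point.\<close>

definition holomorphic_field_on ::
  "(complex \<times> complex) set \<Rightarrow> (complex \<times> complex \<Rightarrow> complex \<times> complex) \<Rightarrow> bool" where
  "holomorphic_field_on S V \<longleftrightarrow>
     (\<forall>m\<in>S. \<exists>D. (V has_derivative D) (at m) \<and>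
        (\<forall>c a b. D (c * a, c * b) = (c * fst (D (a, b)), c * snd (D (a, b)))))"

text \<open>The coordinates \<open>((x, y), (\<xi>, \<eta>))\<close> and \<open>((x, y), (p, q))\<close>, and their extensions by \<open>\<kappa>\<close>.\<close>

type_synonym coords = "(real \<times> real) \<times> (real \<times> real)"
type_synonym coords_ext = "(real \<times> real) \<times> (real \<times> real) \<times> real"

definition xi_eta_coords :: "complex \<times> complex \<Rightarrow> coords" where
  "xi_eta_coords = (\<lambda>(\<tau>, z). ((Re \<tau>, Im \<tau>), (Re z, Im z)))"

definition pq_coords :: "complex \<times> complex \<Rightarrow> coords" where
  "pq_coords = (\<lambda>(\<tau>, z). ((Re \<tau>, Im \<tau>), pq \<tau> z))"

definition xi_eta_coords_ext :: "complex \<times> complex \<times> real \<Rightarrow> coords_ext" where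
  "xi_eta_coords_ext = (\<lambda>(\<tau>, z, k). ((Re \<tau>, Im \<tau>), (Re z, Im z), k))"

definition pq_coords_ext :: "complex \<times> complex \<times> real \<Rightarrow> coords_ext" where
  "pq_coords_ext = (\<lambda>(\<tau>, z, k). ((Re \<tau>, Im \<tau>), pq \<tau> z, k))"


section \<open>Group, action and coordinate laws\<close>

lemmas mat2_simps = vec_eq_iff forall_2 sum_2 det_2 matrix_matrix_mult_def
  vector_matrix_mult_def mat_def

lemma group_GJ1: "group GJ1"
proof (rule groupI)
  fix g assume "g \<in> carrier GJ1"
  then obtain M X k where g: "g = (M, X, k)" and d: "det M = 1"
    by (auto simp: GJ1_def)
  define N :: "real^2^2" where "N = vector [vector [M$2$2, - M$1$2], vector [- M$2$1, M$1$1]]"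
  have d': "M$1$1 * M$2$2 = 1 + M$1$2 * M$2$1" using d by (simp add: det_2)
  have N: "N ** M = mat 1" "det N = 1"
    using d' by (auto simp: N_def mat2_simps algebra_simps)
  have X: "(- (X v* N)) v* M + X = 0"
    using d' by (auto simp: N_def mat2_simps algebra_simps)
  have X': "- (X v* N) v* M = - X" using X by (simp add: add_eq_0_iff2)
  have D: "det (vector [- X, X] :: real^2^2) = 0" by (simp add: det_2)
  show "\<exists>h\<in>carrier GJ1. h \<otimes>\<^bsub>GJ1\<^esub> g = \<one>\<^bsub>GJ1\<^esub>"
    by (rule bexI[of _ "(N, - (X v* N), - k)"]) (use N X X' D in \<open>auto simp: GJ1_def g\<close>)
next
  fix g h k assume "g \<in> carrier GJ1" "h \<in> carrier GJ1" "k \<in> carrier GJ1"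
  then obtain M X r N Y s P Z t where *: "g = (M, X, r)" "h = (N, Y, s)" "k = (P, Z, t)"
    and P: "det P = 1"
    by (auto simp: GJ1_def)
  have "det (vector [(X v* N) v* P, Y v* P] :: real^2^2) = det (vector [X v* N, Y] :: real^2^2)"
  proof -
    have "(vector [(X v* N) v* P, Y v* P] :: real^2^2) = vector [X v* N, Y] ** P"
      by (simp add: vec_eq_iff forall_2 sum_2 matrix_matrix_mult_def vector_matrix_mult_def
          algebra_simps)
    then show ?thesis using P by (simp add: det_mul)
  qed
  moreover have "det (vector [u + v, w] :: real^2^2) = det (vector [u, w] :: real^2^2)
      + det (vector [v, w] :: real^2^2)" "det (vector [u, v + w] :: real^2^2)
      = det (vector [u, v] :: real^2^2) + det (vector [u, w] :: real^2^2)" for u v w :: "real^2"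
    by (simp_all add: det_2 algebra_simps)
  ultimately show "g \<otimes>\<^bsub>GJ1\<^esub> h \<otimes>\<^bsub>GJ1\<^esub> k = g \<otimes>\<^bsub>GJ1\<^esub> (h \<otimes>\<^bsub>GJ1\<^esub> k)"
    by (simp add: GJ1_def * matrix_mul_assoc vector_matrix_left_distrib vector_matrix_mul_assoc
        add.assoc)
next
  fix g h assume "g \<in> carrier GJ1" "h \<in> carrier GJ1"
  then show "g \<otimes>\<^bsub>GJ1\<^esub> h \<in> carrier GJ1" by (auto simp: GJ1_def det_mul)
next
  show "\<one>\<^bsub>GJ1\<^esub> \<in> carrier GJ1" by (simp add: GJ1_def)
next
  fix g assume "g \<in> carrier GJ1"
  then show "\<one>\<^bsub>GJ1\<^esub> \<otimes>\<^bsub>GJ1\<^esub> g = g" by (auto simp: GJ1_def det_2)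
qed

lemma group_GJ0: "group GJ0"
proof (rule groupI)
  fix g assume "g \<in> carrier GJ0"
  then obtain M X where g: "g = (M, X)" and d: "det M = 1"
    by (auto simp: GJ0_def)
  have "(M, X, 0) \<in> carrier GJ1" using d by (simp add: GJ1_def)
  then obtain h where "h \<in> carrier GJ1" "h \<otimes>\<^bsub>GJ1\<^esub> (M, X, 0) = \<one>\<^bsub>GJ1\<^esub>"
    using group.l_inv_ex[OF group_GJ1] by blast
  then show "\<exists>h\<in>carrier GJ0. h \<otimes>\<^bsub>GJ0\<^esub> g = \<one>\<^bsub>GJ0\<^esub>"
    by (intro bexI[of _ "GJ_proj h"]) (auto simp: GJ0_def GJ1_def GJ_proj_def g split: prod.splits)
qed (auto simp: GJ0_def det_mul matrix_mul_assoc vector_matrix_left_distrib vector_matrix_mul_assoc)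

lemma GJ_proj_hom: "GJ_proj \<in> hom GJ1 GJ0"
  by (auto simp: hom_def GJ0_def GJ1_def GJ_proj_def)

lemma GJ_proj_surj: "GJ_proj ` carrier GJ1 = carrier GJ0"
  by (force simp: GJ0_def GJ1_def GJ_proj_def)

lemma GJ_proj_kernel: "kernel GJ1 GJ0 GJ_proj = range (exp_GJ1 GenR)"
  by (auto simp: kernel_def GJ0_def GJ1_def GJ_proj_def)

lemma exp_GJ1_add: "exp_GJ1 Z s \<otimes>\<^bsub>GJ1\<^esub> exp_GJ1 Z t = exp_GJ1 Z (s + t)"
  by (cases Z) (auto simp: GJ1_def mat2_simps algebra_simps simp flip: exp_add)

lemma exp_GJ1_carrier: "exp_GJ1 Z t \<in> carrier GJ1"
  by (cases Z) (auto simp: GJ1_def det_2 mat_def simp flip: exp_add)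

lemma pq_eqI:
  assumes "Im \<tau> > 0" "z = of_real p * \<tau> + of_real q"
  shows "pq \<tau> z = (p, q)"
  unfolding pq_def
proof (rule the_equality)
  fix r assume "z = of_real (fst r) * \<tau> + of_real (snd r)"
  with assms(2) have *: "of_real p * \<tau> + of_real q = of_real (fst r) * \<tau> + of_real (snd r)" by simp
  from arg_cong[OF *, of Im] have "p = fst r" using assms(1) by simp
  with * show "r = (p, q)" by (auto simp: prod_eq_iff)
qed (use assms in auto)

lemma pq_exists:
  assumes "Im \<tau> > 0"
  obtains p q where "z = of_real p * \<tau> + of_real q"
  by (rule that[of "Im z / Im \<tau>" "Re z - Im z / Im \<tau> * Re \<tau>"])
     (use assms in \<open>auto simp: complex_eq_iff\<close>)

lemma denom_nonzero:
  fixes M :: "real^2^2"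
  assumes "det M = 1" "Im \<tau> > 0"
  shows "of_real (M$2$1) * \<tau> + of_real (M$2$2) \<noteq> (0::complex)"
proof
  assume *: "of_real (M$2$1) * \<tau> + of_real (M$2$2) = (0::complex)"
  from arg_cong[OF *, of Im] have c: "M$2$1 = 0" using assms(2) by simp
  with * have "M$2$2 = 0" by simp
  with c assms(1) show False by (simp add: det_2)
qed

lemma act_GJ0_closed:
  assumes "g \<in> carrier GJ0" "m \<in> SJ"
  shows "act_GJ0 g m \<in> SJ"
proof -
  obtain M X where g: "g = (M, X)" and d: "det M = 1" using assms by (auto simp: GJ0_def)
  obtain \<tau> z where m: "m = (\<tau>, z)" and t: "Im \<tau> > 0" using assms by (auto simp: SJ_def)
  let ?a = "M$1$1" and ?b = "M$1$2" and ?c = "M$2$1" and ?d = "M$2$2"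
  let ?j = "of_real ?c * \<tau> + of_real ?d :: complex"
  have j: "?j \<noteq> 0" by (rule denom_nonzero[OF d t])
  have "Im ((of_real ?a * \<tau> + of_real ?b) / ?j) = Im ((of_real ?a * \<tau> + of_real ?b) * cnj ?j) / (cmod ?j)\<^sup>2"
    by (simp add: complex_div_cnj[of _ ?j] Im_divide_of_real flip: of_real_power)
  also have "Im ((of_real ?a * \<tau> + of_real ?b) * cnj ?j) = (?a * ?d - ?b * ?c) * Im \<tau>"
    by (simp add: algebra_simps)
  also have "\<dots> = Im \<tau>" using d by (simp add: det_2)
  finally show ?thesis using t j by (simp add: act_GJ0_def SJ_def g m)
qed

lemma act_GJ0_one: "act_GJ0 \<one>\<^bsub>GJ0\<^esub> m = m"
  by (auto simp: act_GJ0_def GJ0_def mat_def split: prod.splits)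

lemma act_GJ0_mult:
  assumes "g \<in> carrier GJ0" "h \<in> carrier GJ0" "m \<in> SJ"
  shows "act_GJ0 (g \<otimes>\<^bsub>GJ0\<^esub> h) m = act_GJ0 g (act_GJ0 h m)"
proof -
  obtain M X where g: "g = (M, X)" and d: "det M = 1" using assms by (auto simp: GJ0_def)
  obtain N Y where h: "h = (N, Y)" and e: "det N = 1" using assms by (auto simp: GJ0_def)
  obtain \<tau> z where m: "m = (\<tau>, z)" and t: "Im \<tau> > 0" using assms by (auto simp: SJ_def)
  let ?j = "of_real (N$2$1) * \<tau> + of_real (N$2$2) :: complex"
  have j: "?j \<noteq> 0" by (rule denom_nonzero[OF e t])
  have *: "u * (v / ?j) + w = (u * v + w * ?j) / ?j" "v / ?j + w = (v + w * ?j) / ?j"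
    "v / ?j / (w / ?j) = v / w" "u * (v / ?j) * ?j = u * v" for u v w
    using j by (simp_all add: add_divide_distrib)
  show ?thesis
    unfolding g h m act_GJ0_def GJ0_def prod.case monoid.simps *
    by (simp add: mat2_simps algebra_simps)
qed

lemma group_action_restrictI:
  assumes "group G"
    and closed: "\<And>g m. g \<in> carrier G \<Longrightarrow> m \<in> S \<Longrightarrow> act g m \<in> S"
    and one: "\<And>m. m \<in> S \<Longrightarrow> act (one G) m = m"
    and mult: "\<And>g h m. g \<in> carrier G \<Longrightarrow> h \<in> carrier G \<Longrightarrow> m \<in> S
      \<Longrightarrow> act (mult G g h) m = act g (act h m)"
  shows "group_action G S (\<lambda>g. restrict (act g) S)"
proof -
  interpret group G by fact
  have bij: "restrict (act g) S \<in> Bij S" if g: "g \<in> carrier G" for g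
  proof -
    have "bij_betw (act g) S S"
      by (rule bij_betw_byWitness[where f' = "act (m_inv G g)"])
         (use g closed in \<open>auto simp: one simp flip: mult\<close>)
    then show ?thesis by (simp add: Bij_def)
  qed
  show ?thesis
    by (intro group_action.intro group_hom.intro group_hom_axioms.intro homI group_BijGroup
          is_group)
       (auto simp: BijGroup_def bij compose_def mult closed fun_eq_iff)
qed

lemma group_action_GJ0: "group_action GJ0 SJ (\<lambda>g. restrict (act_GJ0 g) SJ)"
  by (rule group_action_restrictI) (simp_all add: group_GJ0 act_GJ0_closed act_GJ0_one act_GJ0_mult)

lemma pq_act:
  assumes d: "det M = 1" and t: "Im \<tau> > 0" and pq: "pq \<tau> z = (p, q)"
  shows "(case act_GJ0 (M, X) (\<tau>, z) of (\<tau>1, z1) \<Rightarrow> pq \<tau>1 z1) =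
    (M$2$2 * (p + X$1) - M$2$1 * (q + X$2), M$1$1 * (q + X$2) - M$1$2 * (p + X$1))"
proof -
  obtain p' q' where z': "z = of_real p' * \<tau> + of_real q'" using pq_exists[OF t] .
  with pq_eqI[OF t z'] pq have z: "z = of_real p * \<tau> + of_real q" by simp
  let ?j = "of_real (M$2$1) * \<tau> + of_real (M$2$2) :: complex"
  have j: "?j \<noteq> 0" by (rule denom_nonzero[OF d t])
  have div_j: "n / ?j = r * (u / ?j) + s" if "n = r * u + s * ?j" for n r s u :: complex
    using j that by (simp add: add_divide_distrib)
  have "Im (fst (act_GJ0 (M, X) (\<tau>, z))) > 0"
    using act_GJ0_closed[of "(M, X)" "(\<tau>, z)"] d t by (auto simp: GJ0_def SJ_def)
  moreover have "M$1$1 * M$2$2 = 1 + M$1$2 * M$2$1"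
    using d by (simp add: det_2)
  from arg_cong[OF this, of complex_of_real]
  have "complex_of_real (M$1$1) * of_real (M$2$2) = 1 + of_real (M$1$2) * of_real (M$2$1)"
    by simp
  then have "z + of_real (X$1) * \<tau> + of_real (X$2) =
      of_real (M$2$2 * (p + X$1) - M$2$1 * (q + X$2)) * (of_real (M$1$1) * \<tau> + of_real (M$1$2))
      + of_real (M$1$1 * (q + X$2) - M$1$2 * (p + X$1)) * ?j"
    unfolding z of_real_diff of_real_mult of_real_add by algebra
  then have "(z + of_real (X$1) * \<tau> + of_real (X$2)) / ?j =
      of_real (M$2$2 * (p + X$1) - M$2$1 * (q + X$2))
        * ((of_real (M$1$1) * \<tau> + of_real (M$1$2)) / ?j)
      + of_real (M$1$1 * (q + X$2) - M$1$2 * (p + X$1))"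
    by (rule div_j)
  ultimately show ?thesis
    unfolding act_GJ0_def prod.case fst_conv by (intro pq_eqI)
qed

lemma act_GJ1_closed:
  assumes "g \<in> carrier GJ1" "m \<in> SJ_ext"
  shows "act_GJ1 g m \<in> SJ_ext"
  using assms act_GJ0_closed[of "GJ_proj g" "(fst m, fst (snd m))"]
  by (auto simp: GJ1_def GJ0_def SJ_def SJ_ext_def act_GJ1_def GJ_proj_def Let_def
      split: prod.splits)

lemma act_GJ1_one: "act_GJ1 \<one>\<^bsub>GJ1\<^esub> m = m"
  using act_GJ0_one
  by (auto simp: act_GJ1_def GJ1_def GJ0_def Let_def split: prod.splits)

lemma act_GJ1_mult:
  assumes "g \<in> carrier GJ1" "h \<in> carrier GJ1" "m \<in> SJ_ext"
  shows "act_GJ1 (g \<otimes>\<^bsub>GJ1\<^esub> h) m = act_GJ1 g (act_GJ1 h m)"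
proof -
  obtain M X k where g: "g = (M, X, k)" and d: "det M = 1" using assms by (auto simp: GJ1_def)
  obtain N Y l where h: "h = (N, Y, l)" and e: "det N = 1" using assms by (auto simp: GJ1_def)
  obtain \<tau> z r where m: "m = (\<tau>, z, r)" and t: "Im \<tau> > 0" using assms by (auto simp: SJ_ext_def)
  obtain p q where pq: "pq \<tau> z = (p, q)" by fastforce
  obtain \<tau>1 z1 where 1: "act_GJ0 (N, Y) (\<tau>, z) = (\<tau>1, z1)" by fastforce
  obtain \<tau>2 z2 where 2: "act_GJ0 (M, X) (\<tau>1, z1) = (\<tau>2, z2)" by fastforce
  have 3: "act_GJ0 (M ** N, X v* N + Y) (\<tau>, z) = (\<tau>2, z2)"
    using act_GJ0_mult[of "(M, X)" "(N, Y)" "(\<tau>, z)"] d e t 1 2 by (simp add: GJ0_def SJ_def)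
  have "pq \<tau>1 z1 = (N$2$2 * (p + Y$1) - N$2$1 * (q + Y$2), N$1$1 * (q + Y$2) - N$1$2 * (p + Y$1))"
    using pq_act[OF e t pq, of Y] 1 by simp
  then have "act_GJ1 g (act_GJ1 h m) = (\<tau>2, z2,
      k + (l + r + Y$1 * q - Y$2 * p) + X$1 * (N$1$1 * (q + Y$2) - N$1$2 * (p + Y$1))
      - X$2 * (N$2$2 * (p + Y$1) - N$2$1 * (q + Y$2)))"
    by (simp add: act_GJ1_def g h m 1 2 pq)
  moreover have "act_GJ1 (g \<otimes>\<^bsub>GJ1\<^esub> h) m = (\<tau>2, z2,
      k + l + det (vector [X v* N, Y] :: real^2^2) + r
      + (X v* N + Y)$1 * q - (X v* N + Y)$2 * p)"
    by (simp add: act_GJ1_def GJ1_def g h m 3 pq)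
  ultimately show ?thesis
    by (simp add: det_2 vector_matrix_mult_def sum_2 algebra_simps)
qed

lemma group_action_GJ1: "group_action GJ1 SJ_ext (\<lambda>g. restrict (act_GJ1 g) SJ_ext)"
  by (rule group_action_restrictI) (simp_all add: group_GJ1 act_GJ1_closed act_GJ1_one act_GJ1_mult)

lemma bij_betw_xi_eta_coords: "bij_betw xi_eta_coords SJ {((x, y), (\<xi>, \<eta>)). y > 0}"
  by (rule bij_betw_byWitness[where f' = "\<lambda>((x, y), (\<xi>, \<eta>)). (Complex x y, Complex \<xi> \<eta>)"])
     (auto simp: xi_eta_coords_def SJ_def)

lemma bij_betw_pq_coords: "bij_betw pq_coords SJ {((x, y), (p, q)). y > 0}"
proof (rule bij_betw_byWitness[where f' = "\<lambda>((x, y), (p, q)).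
    (Complex x y, Complex (p * x + q) (p * y))"])
  show "\<forall>m\<in>SJ. (\<lambda>((x, y), (p, q)). (Complex x y, Complex (p * x + q) (p * y))) (pq_coords m) = m"
  proof
    fix m assume "m \<in> SJ"
    then obtain \<tau> z where m: "m = (\<tau>, z)" and t: "Im \<tau> > 0" by (auto simp: SJ_def)
    obtain p q where z: "z = of_real p * \<tau> + of_real q" using pq_exists[OF t] .
    have "Complex (p * Re \<tau> + q) (p * Im \<tau>) = z" by (simp add: z complex_eq_iff)
    then show "(\<lambda>((x, y), (p, q)). (Complex x y, Complex (p * x + q) (p * y))) (pq_coords m) = m"
      unfolding m pq_coords_def prod.case pq_eqI[OF t z] by simp
  qed
  have "pq (Complex x y) (Complex (p * x + q) (p * y)) = (p, q)" if "y > 0" for x y p q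
    by (rule pq_eqI) (use that in \<open>simp_all add: complex_eq_iff\<close>)
  then show "\<forall>u\<in>{((x, y), (p, q)). y > 0}. pq_coords ((\<lambda>((x, y), (p, q)).
      (Complex x y, Complex (p * x + q) (p * y))) u) = u"
    by (simp add: pq_coords_def split_beta)
  show "pq_coords ` SJ \<subseteq> {((x, y), (p, q)). y > 0}"
    by (simp add: image_subset_iff pq_coords_def SJ_def split_beta)
  show "(\<lambda>((x, y), (p, q)). (Complex x y, Complex (p * x + q) (p * y))) `
      {((x, y), (p, q)). y > 0} \<subseteq> SJ"
    by (simp add: image_subset_iff SJ_def split_beta)
qed

end

theory Submission
  imports Defs
begin

text \<open>
  Each of the twelve fields is the velocity at \<open>t = 0\<close> of an explicit orbit. On
  \<open>(\<tau>, z)\<close> the orbits of the six generators are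
  \<open>(\<tau> + t, z)\<close>, \<open>(\<tau>, z) / (t \<tau> + 1)\<close>, \<open>(e\<^sup>2\<^sup>t \<tau>, e\<^sup>t z)\<close>, \<open>(\<tau>, z + t \<tau>)\<close>, \<open>(\<tau>, z + t)\<close> and \<open>(\<tau>, z)\<close>.
  They are restrictions to real \<open>t\<close> of functions holomorphic near \<open>t = 0\<close>, so ordinary complex
  differentiation gives the velocities, which are polynomial in \<open>(\<tau>, z)\<close> and hence holomorphic.

  The other expressions follow by the chain rule. In the coordinates \<open>(x, y, \<xi>, \<eta>)\<close> one only takes
  real and imaginary parts. In the coordinates \<open>(x, y, p, q)\<close> one differentiates
  \<open>p = \<eta> / y\<close> and \<open>q = \<xi> - p x\<close> (\<open>has_derivative_pq_coords\<close>).

  For the extended space, the \<open>\<kappa>\<close>-component of each orbit is affine in \<open>t\<close>, with a slope that depends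
  on \<open>(\<tau>, z)\<close> alone (\<open>act_exp_GJ1\<close>): it is \<open>q\<close>, \<open>- p\<close>, \<open>1\<close> for \<open>P\<close>, \<open>Q\<close>, \<open>R\<close>, and \<open>0\<close>
  for \<open>F\<close>, \<open>G\<close>, \<open>H\<close>. So the extended fields are those of the first part with this slope as an additional
  component, and the changes of coordinates leave that component alone
  (\<open>expressed_in_coords_extend\<close>).
\<close>

section \<open>Velocities of the orbits\<close>

fun jacobi_field :: "generator \<Rightarrow> complex \<times> complex \<Rightarrow> complex \<times> complex" where
  "jacobi_field GenF (\<tau>, z) = (1, 0)"
| "jacobi_field GenG (\<tau>, z) = (- (\<tau>\<^sup>2), - z * \<tau>)"
| "jacobi_field GenH (\<tau>, z) = (2 * \<tau>, z)"
| "jacobi_field GenP (\<tau>, z) = (0, \<tau>)"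
| "jacobi_field GenQ (\<tau>, z) = (0, 1)"
| "jacobi_field GenR (\<tau>, z) = (0, 0)"

lemmas orbit_simps = act_GJ0_def exp_GJ0_def GJ_proj_def mat_def

lemma is_fundamental_field_jacobi_field:
  "is_fundamental_field SJ act_GJ0 (exp_GJ0 Z) (jacobi_field Z)"
  unfolding is_fundamental_field_def
proof
  fix m assume "m \<in> SJ"
  obtain \<tau> z where m: "m = (\<tau>, z)" by fastforce
  \<comment> \<open>A function of a complex variable that extends the orbit is differentiated at \<open>0\<close> instead.\<close>
  have orbit: "((\<lambda>t. (f (of_real t), g (of_real t))) has_vector_derivative (f', g')) (at 0)"
    if "(f has_field_derivative f') (at 0)" "(g has_field_derivative g') (at 0)"
    for f g :: "complex \<Rightarrow> complex" and f' g'
    using that by (intro has_vector_derivative_Pair has_vector_derivative_real_field) simp_all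
  show "((\<lambda>t. act_GJ0 (exp_GJ0 Z t) m) has_vector_derivative jacobi_field Z m) (at 0)"
  proof (cases Z)
    case GenF
    have "((\<lambda>t. (\<tau> + of_real t, z)) has_vector_derivative (1, 0)) (at (0::real))"
      by (rule orbit) (auto intro!: derivative_eq_intros)
    then show ?thesis by (simp add: GenF m orbit_simps)
  next
    case GenG
    have "((\<lambda>t. (\<tau> / (of_real t * \<tau> + 1), z / (of_real t * \<tau> + 1)))
        has_vector_derivative (- (\<tau>\<^sup>2), - z * \<tau>)) (at (0::real))"
      by (rule orbit) (auto intro!: derivative_eq_intros simp: power2_eq_square)
    then show ?thesis by (simp add: GenG m orbit_simps)
  next
    case GenH
    have "((\<lambda>t. (exp (of_real t) * \<tau> / exp (- of_real t), z / exp (- of_real t)))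
        has_vector_derivative (2 * \<tau>, z)) (at (0::real))"
      by (rule orbit) (auto intro!: derivative_eq_intros)
    then show ?thesis by (simp add: GenH m orbit_simps flip: exp_of_real)
  next
    case GenP
    have "((\<lambda>t. (\<tau>, z + of_real t * \<tau>)) has_vector_derivative (0, \<tau>)) (at (0::real))"
      by (rule orbit) (auto intro!: derivative_eq_intros)
    then show ?thesis by (simp add: GenP m orbit_simps)
  next
    case GenQ
    have "((\<lambda>t. (\<tau>, z + of_real t)) has_vector_derivative (0, 1)) (at (0::real))"
      by (rule orbit) (auto intro!: derivative_eq_intros)
    then show ?thesis by (simp add: GenQ m orbit_simps)
  next
    case GenR
    then show ?thesis by (simp add: m orbit_simps flip: zero_prod_def)
  qed
qed

lemma holomorphic_jacobi_field: "holomorphic_field_on S (jacobi_field Z)"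
  unfolding holomorphic_field_on_def
proof
  fix m :: "complex \<times> complex"
  define D where "D = (\<lambda>(a, b). case Z of
      GenG \<Rightarrow> (- (2 * fst m * a), - (snd m * a + b * fst m))
    | GenH \<Rightarrow> (2 * a, b)
    | GenP \<Rightarrow> (0, a)
    | _ \<Rightarrow> (0, 0))"
  have field: "jacobi_field Z = (\<lambda>m. case Z of
      GenF \<Rightarrow> (1, 0)
    | GenG \<Rightarrow> (- ((fst m)\<^sup>2), - snd m * fst m)
    | GenH \<Rightarrow> (2 * fst m, snd m)
    | GenP \<Rightarrow> (0, fst m)
    | GenQ \<Rightarrow> (0, 1)
    | GenR \<Rightarrow> (0, 0))"
    by (cases Z) (auto simp: fun_eq_iff)
  have "(jacobi_field Z has_derivative D) (at m)"
    unfolding field D_def split_beta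
    by (cases Z) (auto intro!: derivative_eq_intros simp: fun_eq_iff simp flip: zero_prod_def)
  moreover have "D (c * a, c * b) = (c * fst (D (a, b)), c * snd (D (a, b)))" for c a b
    by (cases Z) (simp_all add: D_def algebra_simps)
  ultimately show "\<exists>D. (jacobi_field Z has_derivative D) (at m) \<and>
      (\<forall>c a b. D (c * a, c * b) = (c * fst (D (a, b)), c * snd (D (a, b))))"
    by blast
qed


section \<open>The coordinate changes\<close>

lemma pq_explicit:
  assumes "Im \<tau> > 0"
  shows "pq \<tau> z = (Im z / Im \<tau>, Re z - Im z / Im \<tau> * Re \<tau>)"
  by (rule pq_eqI) (use assms in \<open>auto simp: complex_eq_iff\<close>)

lemma fst_pq:
  assumes "Im \<tau> > 0"
  shows "fst (pq \<tau> z) = Im z / Im \<tau>"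
  using assms by (simp add: pq_explicit)

lemma snd_pq:
  assumes "Im \<tau> > 0"
  shows "snd (pq \<tau> z) = Im (cnj z * \<tau>) / Im \<tau>"
  using assms by (simp add: pq_explicit field_simps)

lemma open_SJ: "open SJ"
proof -
  have "SJ = {m. 0 < Im (fst m)}" by (auto simp: SJ_def)
  moreover have "open {m :: complex \<times> complex. 0 < Im (fst m)}"
    by (intro open_Collect_less continuous_intros)
  ultimately show ?thesis by simp
qed

lemma has_derivative_xi_eta_coords:
  "(xi_eta_coords has_derivative (\<lambda>(a, b). ((Re a, Im a), (Re b, Im b)))) (at m)"
  unfolding xi_eta_coords_def split_beta
  by (auto intro!: derivative_eq_intros)

text \<open>
  The last two components are \<open>dp = (d\<eta> - p dy) / y\<close> and \<open>dq = d\<xi> - p dx - x dp\<close>, obtained from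
  \<open>\<eta> = p y\<close> and \<open>\<xi> = p x + q\<close>.
\<close>

lemma has_derivative_pq_coords:
  assumes "Im \<tau> > 0" and p: "p = Im z / Im \<tau>"
  shows "(pq_coords has_derivative (\<lambda>(a, b).
      let dp = (Im b - p * Im a) / Im \<tau>
      in ((Re a, Im a), (dp, Re b - p * Re a - Re \<tau> * dp)))) (at (\<tau>, z))"
proof -
  have "((\<lambda>m. ((Re (fst m), Im (fst m)), (Im (snd m) / Im (fst m),
      Re (snd m) - Im (snd m) / Im (fst m) * Re (fst m)))) has_derivative (\<lambda>(a, b).
      let dp = (Im b - p * Im a) / Im \<tau>
      in ((Re a, Im a), (dp, Re b - p * Re a - Re \<tau> * dp)))) (at (\<tau>, z))"
    using assms(1)
    by (auto intro!: derivative_eq_intros simp: p Let_def fun_eq_iff)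
       (auto simp: field_simps)
  \<comment> \<open>\<open>pq\<close> is given by the formula only where \<open>Im \<tau> > 0\<close>, which is an open condition.\<close>
  then show ?thesis
  proof (rule has_derivative_transform_within_open[OF _ open_SJ])
    show "(\<tau>, z) \<in> SJ" using assms(1) by (simp add: SJ_def)
  qed (auto simp: SJ_def pq_coords_def pq_explicit)
qed

fun xi_eta_field :: "generator \<Rightarrow> coords \<Rightarrow> coords" where
  "xi_eta_field GenF ((x, y), (\<xi>, \<eta>)) = ((1, 0), (0, 0))"
| "xi_eta_field GenG ((x, y), (\<xi>, \<eta>)) =
    ((y\<^sup>2 - x\<^sup>2, - 2 * x * y), (\<eta> * y - \<xi> * x, - (\<xi> * y + x * \<eta>)))"
| "xi_eta_field GenH ((x, y), (\<xi>, \<eta>)) = ((2 * x, 2 * y), (\<xi>, \<eta>))"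
| "xi_eta_field GenP ((x, y), (\<xi>, \<eta>)) = ((0, 0), (x, y))"
| "xi_eta_field GenQ ((x, y), (\<xi>, \<eta>)) = ((0, 0), (1, 0))"
| "xi_eta_field GenR ((x, y), (\<xi>, \<eta>)) = ((0, 0), (0, 0))"

fun pq_field :: "generator \<Rightarrow> coords \<Rightarrow> coords" where
  "pq_field GenF ((x, y), (p, q)) = ((1, 0), (0, - p))"
| "pq_field GenG ((x, y), (p, q)) = ((y\<^sup>2 - x\<^sup>2, - 2 * x * y), (- q, 0))"
| "pq_field GenH ((x, y), (p, q)) = ((2 * x, 2 * y), (- p, q))"
| "pq_field GenP ((x, y), (p, q)) = ((0, 0), (1, 0))"
| "pq_field GenQ ((x, y), (p, q)) = ((0, 0), (0, 1))"
| "pq_field GenR ((x, y), (p, q)) = ((0, 0), (0, 0))"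

lemma expressed_in_xi_eta_coords:
  "expressed_in_coords SJ xi_eta_coords (jacobi_field Z) (xi_eta_field Z)"
  unfolding expressed_in_coords_def
proof (intro ballI exI conjI)
  fix m
  show "(xi_eta_coords has_derivative (\<lambda>(a, b). ((Re a, Im a), (Re b, Im b)))) (at m)"
    by (rule has_derivative_xi_eta_coords)
  show "(\<lambda>(a, b). ((Re a, Im a), (Re b, Im b))) (jacobi_field Z m) = xi_eta_field Z (xi_eta_coords m)"
    by (cases Z; cases m) (simp_all add: xi_eta_coords_def power2_eq_square algebra_simps)
qed

lemma expressed_in_pq_coords:
  "expressed_in_coords SJ pq_coords (jacobi_field Z) (pq_field Z)"
  unfolding expressed_in_coords_def
proof
  fix m assume "m \<in> SJ"
  then obtain \<tau> z where m: "m = (\<tau>, z)" and y: "Im \<tau> > 0" by (auto simp: SJ_def)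
  let ?p = "Im z / Im \<tau>"
  let ?D = "\<lambda>(a, b). let dp = (Im b - ?p * Im a) / Im \<tau>
    in ((Re a, Im a), (dp, Re b - ?p * Re a - Re \<tau> * dp))"
  have "?D (jacobi_field Z m) = pq_field Z (pq_coords m)"
    using y
    by (cases Z)
       (simp_all add: m pq_coords_def pq_explicit Let_def power2_eq_square field_simps)
  then show "\<exists>D. (pq_coords has_derivative D) (at m) \<and> D (jacobi_field Z m) = pq_field Z (pq_coords m)"
    using has_derivative_pq_coords[OF y refl, of z] unfolding m by blast
qed


section \<open>The extension by the central variable\<close>

fun kappa_slope :: "generator \<Rightarrow> complex \<times> complex \<Rightarrow> real" where
  "kappa_slope GenP (\<tau>, z) = snd (pq \<tau> z)"
| "kappa_slope GenQ (\<tau>, z) = - fst (pq \<tau> z)"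
| "kappa_slope GenR (\<tau>, z) = 1"
| "kappa_slope _ (\<tau>, z) = 0"

definition extend_field ::
  "('a \<times> 'b \<Rightarrow> 'a \<times> 'b) \<Rightarrow> ('a \<times> 'b \<Rightarrow> real) \<Rightarrow> 'a \<times> 'b \<times> real \<Rightarrow> 'a \<times> 'b \<times> real" where
  "extend_field V s = (\<lambda>(u, v, k). (fst (V (u, v)), snd (V (u, v)), s (u, v)))"

text \<open>
  The cocycle \<open>\<lambda> q' - \<mu> p'\<close> is evaluated at the starting point of the orbit, and \<open>(\<lambda>, \<mu>)\<close> is linear
  in \<open>t\<close> along every generator; hence the \<open>\<kappa>\<close>-component is affine in \<open>t\<close> for all \<open>t\<close>, not only to
  first order.
\<close>

lemma act_exp_GJ1:
  "act_GJ1 (exp_GJ1 Z t) (\<tau>, z, k) =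
    (fst (act_GJ0 (exp_GJ0 Z t) (\<tau>, z)), snd (act_GJ0 (exp_GJ0 Z t) (\<tau>, z)),
     k + t * kappa_slope Z (\<tau>, z))"
  by (cases Z) (simp_all add: act_GJ1_def exp_GJ0_def GJ_proj_def split_beta)

lemma is_fundamental_field_extend:
  "is_fundamental_field SJ_ext act_GJ1 (exp_GJ1 Z) (extend_field (jacobi_field Z) (kappa_slope Z))"
  unfolding is_fundamental_field_def
proof
  fix m assume "m \<in> SJ_ext"
  then obtain \<tau> z k where m: "m = (\<tau>, z, k)" and "(\<tau>, z) \<in> SJ"
    by (auto simp: SJ_ext_def SJ_def)
  then have "((\<lambda>t. act_GJ0 (exp_GJ0 Z t) (\<tau>, z)) has_vector_derivative jacobi_field Z (\<tau>, z)) (at 0)"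
    using is_fundamental_field_jacobi_field by (auto simp: is_fundamental_field_def)
  from bounded_linear.has_vector_derivative[OF bounded_linear_fst this]
    bounded_linear.has_vector_derivative[OF bounded_linear_snd this]
  have "((\<lambda>t. (fst (act_GJ0 (exp_GJ0 Z t) (\<tau>, z)), snd (act_GJ0 (exp_GJ0 Z t) (\<tau>, z)),
      k + t * kappa_slope Z (\<tau>, z))) has_vector_derivative
      (fst (jacobi_field Z (\<tau>, z)), snd (jacobi_field Z (\<tau>, z)), kappa_slope Z (\<tau>, z))) (at 0)"
    by (intro has_vector_derivative_Pair) (auto intro!: derivative_eq_intros)
  then show "((\<lambda>t. act_GJ1 (exp_GJ1 Z t) m) has_vector_derivative
      extend_field (jacobi_field Z) (kappa_slope Z) m) (at 0)"
    by (simp add: m act_exp_GJ1 extend_field_def)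
qed

text \<open>
  The differential of \<open>\<phi> \<times> id\<close> is \<open>d\<phi> \<times> id\<close>. The slope \<open>s\<close> is a function on the manifold, whereas
  the \<open>\<kappa>\<close>-component of \<open>W'\<close> is one on the coordinate space; only the points with coordinates
  \<open>\<phi> (u, v)\<close>, \<open>(u, v) \<in> S\<close>, have to be compared.
\<close>

lemma expressed_in_coords_extend:
  fixes \<phi> :: "'a::real_normed_vector \<times> 'b::real_normed_vector
    \<Rightarrow> 'c::real_normed_vector \<times> 'd::real_normed_vector"
  assumes V: "expressed_in_coords S \<phi> V W"
    and W': "\<And>u v k. (u, v) \<in> S \<Longrightarrow> W' (fst (\<phi> (u, v)), snd (\<phi> (u, v)), k) =
      (fst (W (\<phi> (u, v))), snd (W (\<phi> (u, v))), s (u, v))"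
  shows "expressed_in_coords {(u, v, k). (u, v) \<in> S}
    (\<lambda>(u, v, k). (fst (\<phi> (u, v)), snd (\<phi> (u, v)), k)) (extend_field V s) W'"
  unfolding expressed_in_coords_def
proof
  fix m :: "'a \<times> 'b \<times> real" assume "m \<in> {(u, v, k). (u, v) \<in> S}"
  then obtain u v k where m: "m = (u, v, k)" and uv: "(u, v) \<in> S" by blast
  then obtain D where D: "(\<phi> has_derivative D) (at (u, v))" and DV: "D (V (u, v)) = W (\<phi> (u, v))"
    using V by (auto simp: expressed_in_coords_def)
  have "((\<lambda>m. (fst m, fst (snd m))) has_derivative (\<lambda>m. (fst m, fst (snd m)))) (at m)"
    by (auto intro!: derivative_eq_intros)
  moreover have "(\<phi> has_derivative D) (at (fst m, fst (snd m)))"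
    using D by (simp add: m)
  ultimately have "((\<lambda>m. \<phi> (fst m, fst (snd m))) has_derivative (\<lambda>d. D (fst d, fst (snd d)))) (at m)"
    by (rule has_derivative_compose)
  then have "((\<lambda>(u, v, k). (fst (\<phi> (u, v)), snd (\<phi> (u, v)), k)) has_derivative
      (\<lambda>(a, b, c). (fst (D (a, b)), snd (D (a, b)), c))) (at m)"
    unfolding split_beta by (auto intro!: derivative_eq_intros)
  moreover have "(\<lambda>(a, b, c). (fst (D (a, b)), snd (D (a, b)), c)) (extend_field V s m) =
      W' ((\<lambda>(u, v, k). (fst (\<phi> (u, v)), snd (\<phi> (u, v)), k)) m)"
    using W'[OF uv] DV by (simp add: m extend_field_def)
  ultimately show "\<exists>D. ((\<lambda>(u, v, k). (fst (\<phi> (u, v)), snd (\<phi> (u, v)), k)) has_derivative D) (at m) \<and>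
      D (extend_field V s m) = W' ((\<lambda>(u, v, k). (fst (\<phi> (u, v)), snd (\<phi> (u, v)), k)) m)"
    by blast
qed

lemma fundamental_field_in_coords_extend:
  assumes V: "expressed_in_coords SJ \<phi> (jacobi_field Z) W"
    and \<phi>': "\<phi>' = (\<lambda>(\<tau>, z, k). (fst (\<phi> (\<tau>, z)), snd (\<phi> (\<tau>, z)), k))"
    and W': "\<And>\<tau> z k. Im \<tau> > 0 \<Longrightarrow> W' (fst (\<phi> (\<tau>, z)), snd (\<phi> (\<tau>, z)), k) =
      (fst (W (\<phi> (\<tau>, z))), snd (W (\<phi> (\<tau>, z))), kappa_slope Z (\<tau>, z))"
  shows "is_fundamental_field_in \<phi>' SJ_ext act_GJ1 (exp_GJ1 Z) W'"
proof -
  have "SJ_ext = {(\<tau>, z, k). (\<tau>, z) \<in> SJ}" by (auto simp: SJ_ext_def SJ_def)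
  moreover have "expressed_in_coords {(\<tau>, z, k). (\<tau>, z) \<in> SJ} \<phi>'
      (extend_field (jacobi_field Z) (kappa_slope Z)) W'"
    unfolding \<phi>' by (rule expressed_in_coords_extend[OF V]) (simp add: W' SJ_def)
  ultimately show ?thesis
    using is_fundamental_field_extend by (auto simp: is_fundamental_field_in_def)
qed


section \<open>The fundamental vector fields\<close>

theorem proposition5p2:
  fixes F1 G1 H1 :: "real \<times> real \<Rightarrow> real \<times> real"
  assumes F1: "F1 = (\<lambda>(x, y). (1, 0))"
    and G1: "G1 = (\<lambda>(x, y). (y\<^sup>2 - x\<^sup>2, - 2 * x * y))"
    and H1: "H1 = (\<lambda>(x, y). (2 * x, 2 * y))"
  shows
    \<comment> \<open>(1) in \<open>(\<tau>, z)\<close>, \<open>(x, y, \<xi>, \<eta>)\<close>, \<open>(x, y, p, q)\<close>;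
      (2) in \<open>(\<tau>, z, \<kappa>)\<close>, \<open>(x, y, \<xi>, \<eta>, \<kappa>)\<close>, \<open>(x, y, p, q, \<kappa>)\<close>\<close>
   "(\<forall>Z. let V = (case Z of
           GenF \<Rightarrow> (\<lambda>(\<tau>, z). (1, 0))
         | GenG \<Rightarrow> (\<lambda>(\<tau>, z). (- (\<tau>\<^sup>2), - z * \<tau>))
         | GenH \<Rightarrow> (\<lambda>(\<tau>, z). (2 * \<tau>, z))
         | GenP \<Rightarrow> (\<lambda>(\<tau>, z). (0, \<tau>))
         | GenQ \<Rightarrow> (\<lambda>(\<tau>, z). (0, 1))
         | GenR \<Rightarrow> (\<lambda>(\<tau>, z). (0, 0)))
       in is_fundamental_field SJ act_GJ0 (exp_GJ0 Z) V \<and> holomorphic_field_on SJ V) \<and>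
    (\<forall>Z. is_fundamental_field_in xi_eta_coords SJ act_GJ0 (exp_GJ0 Z) (case Z of
           GenF \<Rightarrow> (\<lambda>((x, y), (\<xi>, \<eta>)). (F1 (x, y), (0, 0)))
         | GenG \<Rightarrow> (\<lambda>((x, y), (\<xi>, \<eta>)). (G1 (x, y), (\<eta> * y - \<xi> * x, - (\<xi> * y + x * \<eta>))))
         | GenH \<Rightarrow> (\<lambda>((x, y), (\<xi>, \<eta>)). (H1 (x, y), (\<xi>, \<eta>)))
         | GenP \<Rightarrow> (\<lambda>((x, y), (\<xi>, \<eta>)). ((0, 0), (x, y)))
         | GenQ \<Rightarrow> (\<lambda>((x, y), (\<xi>, \<eta>)). ((0, 0), (1, 0)))
         | GenR \<Rightarrow> (\<lambda>((x, y), (\<xi>, \<eta>)). ((0, 0), (0, 0))))) \<and>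
    (\<forall>Z. is_fundamental_field_in pq_coords SJ act_GJ0 (exp_GJ0 Z) (case Z of
           GenF \<Rightarrow> (\<lambda>((x, y), (p, q)). (F1 (x, y), (0, - p)))
         | GenG \<Rightarrow> (\<lambda>((x, y), (p, q)). (G1 (x, y), (- q, 0)))
         | GenH \<Rightarrow> (\<lambda>((x, y), (p, q)). (H1 (x, y), (- p, q)))
         | GenP \<Rightarrow> (\<lambda>((x, y), (p, q)). ((0, 0), (1, 0)))
         | GenQ \<Rightarrow> (\<lambda>((x, y), (p, q)). ((0, 0), (0, 1)))
         | GenR \<Rightarrow> (\<lambda>((x, y), (p, q)). ((0, 0), (0, 0))))) \<and>
    (\<forall>Z. is_fundamental_field SJ_ext act_GJ1 (exp_GJ1 Z) (case Z of
           GenF \<Rightarrow> (\<lambda>(\<tau>, z, \<kappa>). (1, 0, 0))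
         | GenG \<Rightarrow> (\<lambda>(\<tau>, z, \<kappa>). (- (\<tau>\<^sup>2), - z * \<tau>, 0))
         | GenH \<Rightarrow> (\<lambda>(\<tau>, z, \<kappa>). (2 * \<tau>, z, 0))
         | GenP \<Rightarrow> (\<lambda>(\<tau>, z, \<kappa>). (0, \<tau>, Im (cnj z * \<tau>) / Im \<tau>))
         | GenQ \<Rightarrow> (\<lambda>(\<tau>, z, \<kappa>). (0, 1, - (Im z / Im \<tau>)))
         | GenR \<Rightarrow> (\<lambda>(\<tau>, z, \<kappa>). (0, 0, 1)))) \<and>
    (\<forall>Z. is_fundamental_field_in xi_eta_coords_ext SJ_ext act_GJ1 (exp_GJ1 Z) (case Z of
           GenF \<Rightarrow> (\<lambda>((x, y), (\<xi>, \<eta>), \<kappa>). (F1 (x, y), (0, 0), 0))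
         | GenG \<Rightarrow> (\<lambda>((x, y), (\<xi>, \<eta>), \<kappa>). (G1 (x, y), (\<eta> * y - \<xi> * x, - (\<xi> * y + x * \<eta>)), 0))
         | GenH \<Rightarrow> (\<lambda>((x, y), (\<xi>, \<eta>), \<kappa>). (H1 (x, y), (\<xi>, \<eta>), 0))
         | GenP \<Rightarrow> (\<lambda>((x, y), (\<xi>, \<eta>), \<kappa>).
             let \<tau> = Complex x y; z = Complex \<xi> \<eta>; q = Im (cnj z * \<tau>) / Im \<tau>
             in ((0, 0), (x, y), q))
         | GenQ \<Rightarrow> (\<lambda>((x, y), (\<xi>, \<eta>), \<kappa>).
             let \<tau> = Complex x y; z = Complex \<xi> \<eta>; p = Im z / Im \<tau>
             in ((0, 0), (1, 0), - p))
         | GenR \<Rightarrow> (\<lambda>((x, y), (\<xi>, \<eta>), \<kappa>). ((0, 0), (0, 0), 1)))) \<and>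
    (\<forall>Z. is_fundamental_field_in pq_coords_ext SJ_ext act_GJ1 (exp_GJ1 Z) (case Z of
           GenF \<Rightarrow> (\<lambda>((x, y), (p, q), \<kappa>). (F1 (x, y), (0, - p), 0))
         | GenG \<Rightarrow> (\<lambda>((x, y), (p, q), \<kappa>). (G1 (x, y), (- q, 0), 0))
         | GenH \<Rightarrow> (\<lambda>((x, y), (p, q), \<kappa>). (H1 (x, y), (- p, q), 0))
         | GenP \<Rightarrow> (\<lambda>((x, y), (p, q), \<kappa>). ((0, 0), (1, 0), q))
         | GenQ \<Rightarrow> (\<lambda>((x, y), (p, q), \<kappa>). ((0, 0), (0, 1), - p))
         | GenR \<Rightarrow> (\<lambda>((x, y), (p, q), \<kappa>). ((0, 0), (0, 0), 1))))"
proof (intro conjI allI, goal_cases)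
  case (1 Z)
  show ?case
  proof -
    let ?V = "case Z of
           GenF \<Rightarrow> (\<lambda>(\<tau>, z). (1, 0))
         | GenG \<Rightarrow> (\<lambda>(\<tau>, z). (- (\<tau>\<^sup>2), - z * \<tau>))
         | GenH \<Rightarrow> (\<lambda>(\<tau>, z). (2 * \<tau>, z))
         | GenP \<Rightarrow> (\<lambda>(\<tau>, z). (0, \<tau>))
         | GenQ \<Rightarrow> (\<lambda>(\<tau>, z). (0, 1))
         | GenR \<Rightarrow> (\<lambda>(\<tau>, z). (0, 0))"
    have "?V = jacobi_field Z" by (cases Z) (auto simp: fun_eq_iff)
    then show ?thesis
      by (simp only: Let_def is_fundamental_field_jacobi_field holomorphic_jacobi_field simp_thms)
  qed
next
  case (2 Z)
  have "is_fundamental_field_in xi_eta_coords SJ act_GJ0 (exp_GJ0 Z) (xi_eta_field Z)"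
    using is_fundamental_field_jacobi_field expressed_in_xi_eta_coords
    by (auto simp: is_fundamental_field_in_def)
  then show ?case
    by (rule back_subst[of "is_fundamental_field_in _ _ _ _"])
       (cases Z; auto simp: fun_eq_iff F1 G1 H1)
next
  case (3 Z)
  have "is_fundamental_field_in pq_coords SJ act_GJ0 (exp_GJ0 Z) (pq_field Z)"
    using is_fundamental_field_jacobi_field expressed_in_pq_coords
    by (auto simp: is_fundamental_field_in_def)
  then show ?case
    by (rule back_subst[of "is_fundamental_field_in _ _ _ _"])
       (cases Z; auto simp: fun_eq_iff F1 G1 H1)
next
  case (4 Z)
  \<comment> \<open>The formulas for \<open>p\<close> and \<open>q\<close> agree with \<open>pq\<close> on \<open>SJ_ext\<close>, so the fields are compared there.\<close>
  show ?case
    unfolding is_fundamental_field_def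
  proof
    fix m assume m: "m \<in> SJ_ext"
    have "((\<lambda>t. act_GJ1 (exp_GJ1 Z t) m) has_vector_derivative
        extend_field (jacobi_field Z) (kappa_slope Z) m) (at 0)"
      using is_fundamental_field_extend m by (auto simp: is_fundamental_field_def)
    then show "((\<lambda>t. act_GJ1 (exp_GJ1 Z t) m) has_vector_derivative (case Z of
           GenF \<Rightarrow> (\<lambda>(\<tau>, z, \<kappa>). (1, 0, 0))
         | GenG \<Rightarrow> (\<lambda>(\<tau>, z, \<kappa>). (- (\<tau>\<^sup>2), - z * \<tau>, 0))
         | GenH \<Rightarrow> (\<lambda>(\<tau>, z, \<kappa>). (2 * \<tau>, z, 0))
         | GenP \<Rightarrow> (\<lambda>(\<tau>, z, \<kappa>). (0, \<tau>, Im (cnj z * \<tau>) / Im \<tau>))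
         | GenQ \<Rightarrow> (\<lambda>(\<tau>, z, \<kappa>). (0, 1, - (Im z / Im \<tau>)))
         | GenR \<Rightarrow> (\<lambda>(\<tau>, z, \<kappa>). (0, 0, 1))) m) (at 0)"
      by (rule back_subst[of "\<lambda>v. (_ has_vector_derivative v) (at 0)"])
         (use m in \<open>cases Z; auto simp: extend_field_def SJ_ext_def fst_pq snd_pq\<close>)
  qed
next
  case (5 Z)
  show ?case
    by (rule fundamental_field_in_coords_extend[OF expressed_in_xi_eta_coords])
       (cases Z; force simp: xi_eta_coords_ext_def xi_eta_coords_def F1 G1 H1 fst_pq snd_pq)+
next
  case (6 Z)
  show ?case
  proof (rule fundamental_field_in_coords_extend[OF expressed_in_pq_coords], goal_cases)
    case 1
    then show ?case by (auto simp: pq_coords_ext_def pq_coords_def fun_eq_iff)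
  next
    case (2 \<tau> z k)
    obtain p q where "pq \<tau> z = (p, q)" by fastforce
    then show ?case by (cases Z) (simp_all add: pq_coords_def F1 G1 H1)
  qed
qed

end
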